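(* If $u\in\mathbb{P}^*$ then $F(u;t,x)$, $S(u;t,x)$, and $A(u;t,x)$ are all rational functions of $t$ and $x$.
   Context: $\mathbb{P}$ is the positive integers with the usual order; $\mathbb{P}^*$ is the set of finite words over $\mathbb{P}$. Generalized factor order: $u\le w$ iff there is a factor $w'$ of $w$ (consecutive letters) with $|w'|=|u|$ and $u_i\le w'_i$ for all $i$; such $w'$ is an embedding. $\mathcal{F}(u)=\{w:w\ge u\}$; $\mathcal{S}(u)$ is the set of $w\in\mathcal{F}(u)$ for which every embedding of $u$ into $w$ is a suffix of $w$; $\mathcal{A}(u)=\{w:w\not\ge u\}$. The weight of $w=w_1\cdots w_\ell$ is $t^{\ell}x^{w_1+\cdots+w_\ell}$, and $F(u;t,x),S(u;t,x),A(u;t,x)$ are the sums of weights over $\mathcal{F}(u),\mathcal{S}(u),\mathcal{A}(u)$. *)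

theory Defs
  imports "HOL-Computational_Algebra.Computational_Algebra"
begin

definition pos_words :: "nat list set" where
  "pos_words = lists {0<..}"

text \<open>
  An embedding of \<open>u\<close> into \<open>w\<close> is an occurrence \<open>w = v @ w' @ z\<close> of a factor \<open>w'\<close>,
  so equal factors at different positions are different embeddings.
\<close>

definition embedding :: "nat list \<Rightarrow> nat list \<Rightarrow> nat list \<Rightarrow> nat list \<Rightarrow> nat list \<Rightarrow> bool" where
  "embedding u w v w' z \<longleftrightarrow> w = v @ w' @ z \<and> list_all2 (\<le>) u w'"

definition gfactor_le :: "nat list \<Rightarrow> nat list \<Rightarrow> bool" where
  "gfactor_le u w \<longleftrightarrow> (\<exists>v w' z. embedding u w v w' z)"

definition words_F :: "nat list \<Rightarrow> nat list set" where
  "words_F u = {w \<in> pos_words. gfactor_le u w}"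

definition words_S :: "nat list \<Rightarrow> nat list set" where
  "words_S u = {w \<in> words_F u. \<forall>v w' z. embedding u w v w' z \<longrightarrow> z = []}"

definition words_A :: "nat list \<Rightarrow> nat list set" where
  "words_A u = {w \<in> pos_words. \<not> gfactor_le u w}"

text \<open>
  The type \<open>rat fps fps\<close> represents power series in \<open>t\<close> and \<open>x\<close>: the outer variable is \<open>t\<close>
  and the inner one is \<open>x\<close>.
\<close>

definition weight :: "nat list \<Rightarrow> rat fps fps" where
  "weight w = fps_X ^ length w * fps_const (fps_X ^ sum_list w)"

lemma finite_words_of_weight:
  assumes "L \<subseteq> pos_words"
  shows "finite {w \<in> L. length w = l \<and> sum_list w = n}"
proof (rule finite_subset)
  show "{w \<in> L. length w = l \<and> sum_list w = n} \<subseteq> {w. set w \<subseteq> {..n} \<and> length w = l}"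
    by (auto dest: member_le_sum_list)
  show "finite {w. set w \<subseteq> {..n} \<and> length w = l}"
    by (rule finite_lists_length_eq) simp
qed

text \<open>
  The sum of the weights over \<open>L\<close>, coefficientwise: only finitely many words of \<open>L\<close> have a
  given weight (\<open>finite_words_of_weight\<close>), and they contribute 1 each to the coefficient of
  that monomial.  For finite \<open>L\<close> it is the plain sum (\<open>weight_gf_finite\<close>).
\<close>

definition weight_gf :: "nat list set \<Rightarrow> rat fps fps" where
  "weight_gf L =
     Abs_fps (\<lambda>l. Abs_fps (\<lambda>n. of_nat (card {w \<in> L. length w = l \<and> sum_list w = n})))"

lemma weight_nth_nth:
  "weight w $ l $ n = (if length w = l \<and> sum_list w = n then 1 else 0)"
  by (auto simp: weight_def fps_X_power_iff fps_mult_right_const_nth)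

lemma weight_gf_finite:
  assumes "finite L"
  shows "weight_gf L = (\<Sum>w\<in>L. weight w)"
proof (rule fps_ext, rule fps_ext)
  fix l n
  show "weight_gf L $ l $ n = (\<Sum>w\<in>L. weight w) $ l $ n"
    using assms by (simp add: weight_gf_def fps_sum_nth weight_nth_nth sum.If_cases Int_def)
qed

definition fps2_of_poly :: "rat poly poly \<Rightarrow> rat fps fps" where
  "fps2_of_poly p = fps_of_poly (map_poly fps_of_poly p)"

lemma fps2_of_poly_nth_nth: "fps2_of_poly p $ i $ j = coeff (coeff p i) j"
  by (simp add: fps2_of_poly_def coeff_map_poly)

text \<open>
  \<open>f = P / Q\<close> in the fraction field of the power series ring, for polynomials \<open>P\<close> and \<open>Q\<close>
  in \<open>t\<close> and \<open>x\<close>, with denominators cleared.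
\<close>

definition rational_fps2 :: "rat fps fps \<Rightarrow> bool" where
  "rational_fps2 f \<longleftrightarrow> (\<exists>P Q. Q \<noteq> 0 \<and> fps2_of_poly Q * f = fps2_of_poly P)"

end

theory Submission imports Defs begin

text \<open>
  Reading a word from the left, all that matters for avoiding \<open>u\<close> is the set of suffixes of
  \<open>u\<close> that, if matched at the front of the rest, would complete an embedding.  So the iterated
  left quotients of \<open>words_A u\<close> are finite in number, and from each of them all sufficiently
  large letters lead to the same quotient.  The generating functions of the quotients therefore
  solve a linear system \<open>G = c + t M G\<close> whose coefficients are rational in \<open>x\<close>; elimination only
  divides by series with constant term 1 in \<open>t\<close>, so the solution is rational.  Finally
  \<open>F + A\<close> counts all words, and appending a letter to a word that avoids \<open>u\<close> yields either a
  nonempty word avoiding \<open>u\<close> or a word of \<open>words_S u\<close>, so that \<open>A + S = 1 + (t x / (1 - x)) A\<close>.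
\<close>

section \<open>Rational power series in two variables\<close>

lemma fps2_of_poly_add: "fps2_of_poly (p + q) = fps2_of_poly p + fps2_of_poly q"
  by (intro fps_ext) (simp add: fps2_of_poly_nth_nth)

lemma fps2_of_poly_diff: "fps2_of_poly (p - q) = fps2_of_poly p - fps2_of_poly q"
  by (intro fps_ext) (simp add: fps2_of_poly_nth_nth)

lemma fps2_of_poly_mult: "fps2_of_poly (p * q) = fps2_of_poly p * fps2_of_poly q"
proof -
  have "map_poly fps_of_poly (p * q) = map_poly fps_of_poly p * map_poly fps_of_poly q"
    by (intro poly_eqI) (simp add: coeff_map_poly coeff_mult fps_of_poly_sum fps_of_poly_mult)
  then show ?thesis by (simp add: fps2_of_poly_def fps_of_poly_mult)
qed

lemma fps2_of_poly_0: "fps2_of_poly 0 = 0"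
  by (intro fps_ext) (simp add: fps2_of_poly_nth_nth)

lemma fps2_of_poly_1: "fps2_of_poly 1 = 1"
  by (simp add: fps2_of_poly_def)

text \<open>Needed when a fraction is inverted: it shows that the numerator may become a
  denominator.\<close>

lemma fps2_of_poly_eq_0_iff: "fps2_of_poly p = 0 \<longleftrightarrow> p = 0"
proof
  assume "fps2_of_poly p = 0"
  then have "coeff (coeff p i) j = 0" for i j
    by (metis fps2_of_poly_nth_nth fps_zero_nth)
  then show "p = 0" by (intro poly_eqI) simp
qed (simp add: fps2_of_poly_0)

lemma rational_fps2I: "Q \<noteq> 0 \<Longrightarrow> fps2_of_poly Q * f = fps2_of_poly P \<Longrightarrow> rational_fps2 f"
  unfolding rational_fps2_def by blast

lemma rational_fps2E:
  assumes "rational_fps2 f"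
  obtains P Q where "Q \<noteq> 0" "fps2_of_poly Q * f = fps2_of_poly P"
  using assms unfolding rational_fps2_def by blast

lemma rational_fps2_of_poly: "rational_fps2 (fps2_of_poly p)"
  by (rule rational_fps2I[of 1 _ p]) (simp_all add: fps2_of_poly_1)

lemma rational_fps2_0: "rational_fps2 0"
  using rational_fps2_of_poly[of 0] by (simp add: fps2_of_poly_0)

lemma rational_fps2_1: "rational_fps2 1"
  using rational_fps2_of_poly[of 1] by (simp add: fps2_of_poly_1)

lemma rational_fps2_X: "rational_fps2 fps_X"
  using rational_fps2_of_poly[of "monom 1 1"]
  by (simp add: fps2_of_poly_def map_poly_monom fps_of_poly_monom)

lemma rational_fps2_mult:
  assumes "rational_fps2 f" "rational_fps2 g"
  shows "rational_fps2 (f * g)"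
proof -
  obtain P Q where f: "Q \<noteq> 0" "fps2_of_poly Q * f = fps2_of_poly P"
    using assms(1) by (rule rational_fps2E)
  obtain P' Q' where g: "Q' \<noteq> 0" "fps2_of_poly Q' * g = fps2_of_poly P'"
    using assms(2) by (rule rational_fps2E)
  show ?thesis
    using f g by (intro rational_fps2I[of "Q * Q'" _ "P * P'"])
      (simp_all add: fps2_of_poly_mult flip: f(2) g(2))
qed

lemma rational_fps2_add:
  assumes "rational_fps2 f" "rational_fps2 g"
  shows "rational_fps2 (f + g)"
proof -
  obtain P Q where f: "Q \<noteq> 0" "fps2_of_poly Q * f = fps2_of_poly P"
    using assms(1) by (rule rational_fps2E)
  obtain P' Q' where g: "Q' \<noteq> 0" "fps2_of_poly Q' * g = fps2_of_poly P'"
    using assms(2) by (rule rational_fps2E)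
  show ?thesis
    using f g by (intro rational_fps2I[of "Q * Q'" _ "P * Q' + P' * Q"])
      (simp_all add: fps2_of_poly_mult fps2_of_poly_add algebra_simps flip: f(2) g(2))
qed

lemma rational_fps2_diff:
  assumes "rational_fps2 f" "rational_fps2 g"
  shows "rational_fps2 (f - g)"
proof -
  have "rational_fps2 (- 1)"
    using rational_fps2_of_poly[of "0 - 1"]
    unfolding fps2_of_poly_diff fps2_of_poly_0 fps2_of_poly_1 by simp
  then have "rational_fps2 (f + (- 1) * g)"
    by (intro rational_fps2_add rational_fps2_mult assms)
  then show ?thesis by simp
qed

lemma rational_fps2_sum:
  assumes "\<And>i. i \<in> I \<Longrightarrow> rational_fps2 (f i)"
  shows "rational_fps2 (\<Sum>i\<in>I. f i)"
  using assms
  by (induction I rule: infinite_finite_induct) (auto intro: rational_fps2_0 rational_fps2_add)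

text \<open>If \<open>f = P / Q\<close> then \<open>g = Q / P\<close>; here \<open>P\<close> cannot
  vanish because \<open>f\<close> is nonzero and power series form an integral domain.\<close>

lemma rational_fps2_inverse:
  assumes "rational_fps2 f" "f * g = 1"
  shows "rational_fps2 g"
proof -
  obtain P Q where f: "Q \<noteq> 0" "fps2_of_poly Q * f = fps2_of_poly P"
    using assms(1) by (rule rational_fps2E)
  have "f \<noteq> 0" using assms(2) by auto
  then have "P \<noteq> 0" using f by (metis fps2_of_poly_eq_0_iff mult_eq_0_iff)
  moreover have "fps2_of_poly P * g = fps2_of_poly Q"
    using assms(2) by (simp add: mult.assoc flip: f(2))
  ultimately show ?thesis by (rule rational_fps2I)
qed

text \<open>Gaussian elimination by induction on the number of unknowns. The pivot
  \<open>1 - m k k\<close> has constant term 1 in \<open>t\<close>, hence is a unit, and the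
  \<open>k\<close>-th equation can be solved for \<open>G k\<close>. The unknowns \<open>G\<close>
  stay fixed while \<open>c\<close> and \<open>m\<close> change, so only the latter are
  generalized.\<close>

lemma rational_fps2_linear_system:
  assumes "finite I"
    and "\<And>i. i \<in> I \<Longrightarrow> G i = c i + (\<Sum>j\<in>I. m i j * G j)"
    and "\<And>i. i \<in> I \<Longrightarrow> rational_fps2 (c i)"
    and "\<And>i j. i \<in> I \<Longrightarrow> j \<in> I \<Longrightarrow> rational_fps2 (m i j)"
    and "\<And>i j. i \<in> I \<Longrightarrow> j \<in> I \<Longrightarrow> m i j $ 0 = 0"
    and "i \<in> I"
  shows "rational_fps2 (G i)"
  using assms
proof (induction I arbitrary: c m i rule: finite_induct)
  case (insert k I)
  note rat = insert.prems(2,3)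
  have "(1 - m k k) $ 0 = 1"
    using insert.prems(4) by simp
  then obtain v where v: "(1 - m k k) * v = 1"
    by (metis fps_is_left_unit_iff_zeroth_is_left_unit mult_1_right)
  have rat_v: "rational_fps2 v"
    using v by (rule rational_fps2_inverse[rotated])
      (intro rational_fps2_diff rational_fps2_1 rat insertI1)
  have "(1 - m k k) * G k = c k + (\<Sum>j\<in>I. m k j * G j)"
    using insert.prems(1)[of k] insert.hyps by (simp add: algebra_simps)
  then have Gk: "G k = v * (c k + (\<Sum>j\<in>I. m k j * G j))"
    using v by (metis mult.commute mult.left_commute mult_1_right)
  \<comment> \<open>Substituting the formula for \<open>G k\<close> gives a system over
    \<open>I\<close>. Its new coefficients again have constant term 0, since \<open>m i k\<close>
    and \<open>m i j\<close> do, so the pivots remain units.\<close>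
  have rat_G: "rational_fps2 (G i)" if "i \<in> I" for i
  proof (rule insert.IH[of "\<lambda>i. c i + m i k * v * c k" "\<lambda>i j. m i j + m i k * v * m k j"])
    fix i assume i: "i \<in> I"
    have "G i = c i + (m i k * G k + (\<Sum>j\<in>I. m i j * G j))"
      using insert.prems(1)[of i] insert.hyps i by simp
    also have "\<dots> = c i + m i k * v * c k + (\<Sum>j\<in>I. (m i j + m i k * v * m k j) * G j)"
      unfolding Gk by (simp add: algebra_simps sum.distrib sum_distrib_left)
    finally show "G i = \<dots>" .
  qed (use that insert.prems(4) in \<open>auto intro!: rational_fps2_add rational_fps2_mult rat rat_v\<close>)
  have "rational_fps2 (G k)"
    unfolding Gk
    by (intro rational_fps2_add rational_fps2_mult rational_fps2_sum rat rat_v rat_G) auto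
  then show ?case using rat_G insert.prems(5) by auto
qed simp

text \<open>Multiplying by \<open>1 - x\<close> turns the coefficients into consecutive differences,
  which vanish beyond \<open>M\<close>; the product is thus a polynomial in
  \<open>x\<close>.\<close>

lemma rational_fps2_const_eventually_constant:
  assumes "\<And>n. n \<ge> M \<Longrightarrow> f $ n = f $ M"
  shows "rational_fps2 (fps_const f)"
proof -
  define p where "p = Poly (map (\<lambda>n. ((1 - fps_X) * f) $ n) [0..<Suc M])"
  have "((1 - fps_X) * f) $ n = 0" if "n \<ge> Suc M" for n
    using that assms[of n] assms[of "n - 1"] by (simp add: left_diff_distrib)
  then have p: "(1 - fps_X) * f = fps_of_poly p"
    by (intro fps_ext) (auto simp: p_def coeff_Poly_eq nth_default_def simp del: upt_Suc)
  \<comment> \<open>The denominator \<open>1 - x\<close>, as a polynomial of degree 0 in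
    \<open>t\<close>.\<close>
  have "fps2_of_poly [:[:1, - 1:]:] = fps_const (1 - fps_X)"
    by (simp add: fps2_of_poly_def map_poly_pCons fps_of_poly_pCons fps_const_neg[symmetric] 
        del: fps_const_neg)
  moreover have "fps2_of_poly [:p:] = fps_const (fps_of_poly p)"
    by (simp add: fps2_of_poly_def map_poly_pCons)
  ultimately show ?thesis
    by (intro rational_fps2I[of "[:[:1, - 1:]:]" _ "[:p:]"]) (simp_all add: p)
qed

section \<open>Generating functions of languages\<close>

lemma weight_gf_nth: "weight_gf L $ l $ n = of_nat (card {w \<in> L. length w = l \<and> sum_list w = n})"
  by (simp add: weight_gf_def)

lemma weight_gf_Un_disjoint:
  assumes "L \<subseteq> pos_words" "L' \<subseteq> pos_words" "L \<inter> L' = {}"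
  shows "weight_gf (L \<union> L') = weight_gf L + weight_gf L'"
proof (intro fps_ext)
  fix l n
  have "{w \<in> L \<union> L'. length w = l \<and> sum_list w = n} =
        {w \<in> L. length w = l \<and> sum_list w = n} \<union> {w \<in> L'. length w = l \<and> sum_list w = n}"
    by auto
  then show "weight_gf (L \<union> L') $ l $ n = (weight_gf L + weight_gf L') $ l $ n"
    using assms finite_words_of_weight
    by (auto simp: weight_gf_nth intro!: card_Un_disjoint simp flip: of_nat_add)
qed

text \<open>Lets facts about first letters be applied to last letters.\<close>

lemma weight_gf_rev: "weight_gf (rev ` L) = weight_gf L"
proof (intro fps_ext)
  fix l n
  have "{w \<in> rev ` L. length w = l \<and> sum_list w = n} =
        rev ` {w \<in> L. length w = l \<and> sum_list w = n}"
    by (auto simp: sum_list_rev)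
  then show "weight_gf (rev ` L) $ l $ n = weight_gf L $ l $ n"
    by (simp add: weight_gf_nth card_image)
qed

lemma weight_gf_nth_0: "weight_gf L $ 0 = (if [] \<in> L then 1 else 0)"
proof (rule fps_ext)
  fix n
  have "{w \<in> L. length w = 0 \<and> sum_list w = n} = (if [] \<in> L \<and> n = 0 then {[]} else {})"
    by auto
  then show "weight_gf L $ 0 $ n = (if [] \<in> L then 1 else 0) $ n"
    by (simp add: weight_gf_nth)
qed

text \<open>The words are sorted by their first letter \<open>a\<close>, which is positive and at
  most the letter sum \<open>n\<close>; so the truncated \<open>n - a\<close> is a true
  difference.\<close>

lemma weight_gf_nth_Suc:
  assumes "L \<subseteq> pos_words"
  shows "weight_gf L $ Suc l $ n = (\<Sum>a\<in>{0<..n}. weight_gf {w. a # w \<in> L} $ l $ (n - a))"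
proof -
  let ?W = "\<lambda>a. {w. a # w \<in> L \<and> length w = l \<and> sum_list w = n - a}"
  have "{w \<in> L. length w = Suc l \<and> sum_list w = n} = (\<Union>a\<in>{0<..n}. (#) a ` ?W a)"
    using assms by (auto simp: length_Suc_conv pos_words_def image_iff)
  moreover have "finite (?W a)" if "a > 0" for a
  proof -
    have "{w. a # w \<in> L} \<subseteq> pos_words"
      using assms by (auto simp: pos_words_def)
    from finite_words_of_weight[OF this, of l "n - a"] show ?thesis by simp
  qed
  ultimately have "card {w \<in> L. length w = Suc l \<and> sum_list w = n} = (\<Sum>a\<in>{0<..n}. card (?W a))"
    by (simp add: card_UN_disjoint card_image) (subst card_UN_disjoint; auto simp: card_image)
  then show ?thesis by (simp add: weight_gf_nth)
qed

text \<open>The weight series of the one-letter words over \<open>B\<close>, with \<open>B\<close>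
  possibly infinite.\<close>

definition letters_gf :: "nat set \<Rightarrow> rat fps fps" where
  "letters_gf B = fps_X * fps_const (Abs_fps (\<lambda>a. if a \<in> B then 1 else 0))"

lemma letters_gf_nth_0: "letters_gf B $ 0 = 0"
  by (simp add: letters_gf_def)

lemma letters_gf_mult_nth_Suc:
  "(letters_gf B * g) $ Suc l $ n = (\<Sum>a\<in>{..n} \<inter> B. g $ l $ (n - a))"
proof -
  have "(letters_gf B * g) $ Suc l $ n = (Abs_fps (\<lambda>a. if a \<in> B then 1 else 0) * g $ l) $ n"
    by (simp add: letters_gf_def mult.assoc fps_mult_left_const_nth)
  also have "\<dots> = (\<Sum>a\<le>n. if a \<in> B then g $ l $ (n - a) else 0)"
    unfolding fps_mult_nth atMost_atLeast0 by (intro sum.cong) auto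
  finally show ?thesis by (simp add: sum.inter_restrict)
qed

text \<open>The hypothesis makes \<open>B\<close> finite or cofinite, so its indicator sequence is
  eventually constant.\<close>

lemma rational_letters_gf:
  assumes "\<And>a. a \<ge> M \<Longrightarrow> a \<in> B \<longleftrightarrow> M \<in> B"
  shows "rational_fps2 (letters_gf B)"
  unfolding letters_gf_def
proof (intro rational_fps2_mult rational_fps2_X rational_fps2_const_eventually_constant[of M])
  fix a assume "a \<ge> M"
  from assms[OF this] show
    "Abs_fps (\<lambda>a. if a \<in> B then 1 else 0) $ a = Abs_fps (\<lambda>a. if a \<in> B then 1 else 0) $ M"
    unfolding fps_nth_Abs_fps by (rule if_cong) (rule refl)+
qed

text \<open>Letters are grouped by the quotient to which they lead. A \<open>J\<close> that no
  letter reaches has coefficient 0, so \<open>K\<close> may be larger than the set of quotients;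
  this allows one common index set for a whole system.\<close>

lemma weight_gf_quotients:
  assumes "L \<subseteq> pos_words" "finite K" "\<And>a. a > 0 \<Longrightarrow> {w. a # w \<in> L} \<in> K"
  shows "weight_gf L = (if [] \<in> L then 1 else 0)
           + (\<Sum>J\<in>K. letters_gf {a. 0 < a \<and> {w. a # w \<in> L} = J} * weight_gf J)"
    (is "_ = ?c + ?s")
proof (rule fps_ext)
  fix l
  show "weight_gf L $ l = (?c + ?s) $ l"
  proof (cases l)
    case 0
    then show ?thesis by (simp add: weight_gf_nth_0 letters_gf_nth_0 fps_sum_nth)
  next
    case (Suc l')
    show ?thesis
    proof (rule fps_ext)
      fix n
      let ?g = "\<lambda>a J. weight_gf J $ l' $ (n - a)"
      let ?q = "\<lambda>a. {w. a # w \<in> L}"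
      have "weight_gf L $ l $ n = (\<Sum>a\<in>{0<..n}. ?g a (?q a))"
        by (simp add: Suc weight_gf_nth_Suc[OF assms(1)])
      also have "\<dots> = (\<Sum>J\<in>K. \<Sum>a\<in>{a \<in> {0<..n}. ?q a = J}. ?g a (?q a))"
        using assms by (intro sum.group[symmetric]) auto
      also have "\<dots> = (\<Sum>J\<in>K. \<Sum>a\<in>{..n} \<inter> {a. 0 < a \<and> ?q a = J}. ?g a J)"
        by (intro sum.cong) auto
      also have "\<dots> = (?c + ?s) $ l $ n"
        by (simp add: Suc fps_sum_nth letters_gf_mult_nth_Suc)
      finally show "weight_gf L $ l $ n = (?c + ?s) $ l $ n" .
    qed
  qed
qed

text \<open>\<open>K\<close> is the state set of a deterministic automaton, each state being the
  language accepted from it. There is one unknown per state. Transitions do not depend on the letter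
  from \<open>M\<close> on, so the coefficients are rational, and their factor \<open>t\<close>
  gives them constant term 0.\<close>

lemma rational_weight_gf_of_finite_quotients:
  assumes "finite K" "\<And>L. L \<in> K \<Longrightarrow> L \<subseteq> pos_words"
    and "\<And>L a. L \<in> K \<Longrightarrow> a > 0 \<Longrightarrow> {w. a # w \<in> L} \<in> K"
    and "\<And>L a. L \<in> K \<Longrightarrow> a \<ge> M \<Longrightarrow> {w. a # w \<in> L} = {w. M # w \<in> L}"
    and "M > 0" "L \<in> K"
  shows "rational_fps2 (weight_gf L)"
proof (rule rational_fps2_linear_system[OF assms(1)])
  fix L assume L: "L \<in> K"
  show "weight_gf L = (if [] \<in> L then 1 else 0)
      + (\<Sum>J\<in>K. letters_gf {a. 0 < a \<and> {w. a # w \<in> L} = J} * weight_gf J)"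
    using assms L by (intro weight_gf_quotients) auto
  show "rational_fps2 (if [] \<in> L then 1 else 0)"
    by (simp add: rational_fps2_0 rational_fps2_1)
  fix J
  show "rational_fps2 (letters_gf {a. 0 < a \<and> {w. a # w \<in> L} = J})"
  proof (rule rational_letters_gf[of M])
    fix a assume "a \<ge> M"
    then show "a \<in> {a. 0 < a \<and> {w. a # w \<in> L} = J} \<longleftrightarrow> M \<in> {a. 0 < a \<and> {w. a # w \<in> L} = J}"
      using assms(4)[OF L, of a] \<open>M > 0\<close> by simp
  qed
qed (use assms in \<open>auto simp: letters_gf_nth_0\<close>)

text \<open>An automaton with a single state: removing a positive first letter leaves an arbitrary
  positive word.\<close>

lemma rational_weight_gf_pos_words: "rational_fps2 (weight_gf pos_words)"
  by (rule rational_weight_gf_of_finite_quotients[of "{pos_words}" 1]) (auto simp: pos_words_def)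

section \<open>Words avoiding u\<close>

definition prefix_match :: "nat list \<Rightarrow> nat list \<Rightarrow> bool" where
  "prefix_match s w \<longleftrightarrow> (\<exists>w' z. w = w' @ z \<and> list_all2 (\<le>) s w')"

lemma prefix_match_Nil [simp]: "prefix_match [] w"
  by (simp add: prefix_match_def)

lemma prefix_match_Cons [simp]: "prefix_match (b # s) (a # w) \<longleftrightarrow> b \<le> a \<and> prefix_match s w"
proof
  assume "b \<le> a \<and> prefix_match s w"
  then obtain w' z where "a # w = (a # w') @ z" "list_all2 (\<le>) (b # s) (a # w')"
    by (auto simp: prefix_match_def)
  then show "prefix_match (b # s) (a # w)" unfolding prefix_match_def by blast
qed (auto simp: prefix_match_def list_all2_Cons1, blast)

lemma gfactor_le_Cons: "gfactor_le u (a # w) \<longleftrightarrow> prefix_match u (a # w) \<or> gfactor_le u w"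
proof
  assume "gfactor_le u (a # w)"
  then obtain v w' z where "a # w = v @ w' @ z" "list_all2 (\<le>) u w'"
    unfolding gfactor_le_def embedding_def by blast
  then show "prefix_match u (a # w) \<or> gfactor_le u w"
    unfolding gfactor_le_def embedding_def prefix_match_def by (cases v) auto
next
  assume "prefix_match u (a # w) \<or> gfactor_le u w"
  then show "gfactor_le u (a # w)"
  proof
    assume "gfactor_le u w"
    then obtain v w' z where "a # w = (a # v) @ w' @ z" "list_all2 (\<le>) u w'"
      unfolding gfactor_le_def embedding_def by auto
    then show ?thesis unfolding gfactor_le_def embedding_def by blast
  next
    assume "prefix_match u (a # w)"
    then obtain w' z where "a # w = [] @ w' @ z" "list_all2 (\<le>) u w'"
      unfolding prefix_match_def by auto
    then show ?thesis unfolding gfactor_le_def embedding_def by blast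
  qed
qed

text \<open>The states of the automaton: \<open>T\<close> holds what remains to be matched of
  embeddings already begun.\<close>

definition avoiding :: "nat list \<Rightarrow> nat list set \<Rightarrow> nat list set" where
  "avoiding u T = {w \<in> words_A u. \<forall>s\<in>T. \<not> prefix_match s w}"

text \<open>The transition on reading \<open>a\<close>. An embedding may start at this letter, hence
  \<open>insert u T\<close>; an entry whose head exceeds \<open>a\<close> has failed and is dropped.
  An empty entry is a completed embedding and is kept, which makes the state permanently dead, as
  \<open>[]\<close> matches everywhere.\<close>

definition pending :: "nat list \<Rightarrow> nat list set \<Rightarrow> nat \<Rightarrow> nat list set" where
  "pending u T a =
     {s. \<exists>b\<le>a. b # s \<in> insert u T} \<union> (if [] \<in> insert u T then {[]} else {})"

lemma quotient_avoiding:
  assumes "a > 0"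
  shows "{w. a # w \<in> avoiding u T} = avoiding u (pending u T a)"
proof -
  \<comment> \<open>By \<open>gfactor_le_Cons\<close>, \<open>a # w\<close> avoids \<open>u\<close>
    iff \<open>w\<close> does and \<open>u\<close> does not match at the front of
    \<open>a # w\<close>. So \<open>u\<close> joins the conditions in \<open>T\<close>.\<close>
  have "(\<forall>s\<in>insert u T. \<not> prefix_match s (a # w)) \<longleftrightarrow>
        (\<forall>s\<in>pending u T a. \<not> prefix_match s w)" for w
  proof
    assume l: "\<forall>s\<in>insert u T. \<not> prefix_match s (a # w)"
    show "\<forall>s\<in>pending u T a. \<not> prefix_match s w"
    proof
      fix s assume "s \<in> pending u T a"
      moreover have "[] \<notin> insert u T" using l prefix_match_Nil by blast
      ultimately obtain b where "b \<le> a" "b # s \<in> insert u T"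
        by (auto simp: pending_def)
      then show "\<not> prefix_match s w" using l prefix_match_Cons by blast
    qed
  next
    assume r: "\<forall>s\<in>pending u T a. \<not> prefix_match s w"
    show "\<forall>s\<in>insert u T. \<not> prefix_match s (a # w)"
    proof
      fix s assume s: "s \<in> insert u T"
      show "\<not> prefix_match s (a # w)"
      proof (cases s)
        case Nil
        then have "[] \<in> pending u T a" using s by (simp add: pending_def)
        then show ?thesis using r by auto
      next
        case (Cons b s')
        then have "b \<le> a \<Longrightarrow> s' \<in> pending u T a" using s by (auto simp: pending_def)
        then show ?thesis using r Cons by auto
      qed
    qed
  qed
  then show ?thesis
    using assms by (auto simp: avoiding_def words_A_def pos_words_def gfactor_le_Cons)
qed

lemma rational_words_A: "rational_fps2 (weight_gf (words_A u))"
proof -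
  \<comment> \<open>\<open>X\<close> is the finite set of suffixes of \<open>u\<close>, and
    \<open>M\<close> exceeds every letter of \<open>u\<close>.\<close>
  define X where "X = (\<lambda>n. drop n u) ` {..length u}"
  define M where "M = Suc (sum_list u)"
  have M_pos: "M > 0" by (simp add: M_def)
  have u_X: "u \<in> X"
    unfolding X_def by (rule image_eqI[of _ _ 0]) auto
  have Nil_X: "[] \<in> X"
    unfolding X_def by (rule image_eqI[of _ _ "length u"]) auto
  have tl_X: "s \<in> X \<and> b < M" if s: "b # s \<in> X" for b s
  proof -
    obtain n where n: "n \<le> length u" "b # s = drop n u" using s by (auto simp: X_def)
    then have "n < length u" by (cases "n = length u") auto
    moreover from this have "s = drop (Suc n) u" using n(2) by (simp add: Cons_nth_drop_Suc[symmetric])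
    moreover have "b \<in> set u" using n by (metis in_set_dropD list.set_intros(1))
    then have "b \<le> sum_list u" by (simp add: member_le_sum_list)
    ultimately show ?thesis by (auto simp: X_def M_def)
  qed
  \<comment> \<open>Closure of the state set: \<open>u\<close>, \<open>[]\<close> and the tail of
    any nonempty suffix of \<open>u\<close> are suffixes of \<open>u\<close>.\<close>
  have pending_X: "pending u T a \<subseteq> X" if "T \<subseteq> X" for T a
    using that u_X Nil_X tl_X unfolding pending_def by (auto split: if_splits)
  \<comment> \<open>From \<open>M\<close> on the comparison \<open>b \<le> a\<close> always
    succeeds, so the transition no longer depends on \<open>a\<close>.\<close>
  have pending_M: "pending u T a = pending u T M" if "T \<subseteq> X" "a \<ge> M" for T a
  proof -
    have "b \<le> a \<and> b \<le> M" if "b # s \<in> insert u T" for b s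
      using that tl_X[of b s] u_X \<open>T \<subseteq> X\<close> \<open>a \<ge> M\<close> by auto
    then show ?thesis unfolding pending_def by blast
  qed
  show ?thesis
  proof (rule rational_weight_gf_of_finite_quotients[of "avoiding u ` Pow X" M])
    show "finite (avoiding u ` Pow X)" by (simp add: X_def)
    \<comment> \<open>The start state: no embedding has begun.\<close>
    show "words_A u \<in> avoiding u ` Pow X"
      by (rule image_eqI[of _ _ "{}"]) (auto simp: avoiding_def)
    show "M > 0" by (rule M_pos)
  next
    fix L assume "L \<in> avoiding u ` Pow X"
    then obtain T where T: "L = avoiding u T" "T \<subseteq> X" by auto
    show "L \<subseteq> pos_words" by (auto simp: T avoiding_def words_A_def)
    show "{w. a # w \<in> L} \<in> avoiding u ` Pow X" if "a > 0" for a
      using that pending_X[OF T(2)] by (simp add: T(1) quotient_avoiding)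
    show "{w. a # w \<in> L} = {w. M # w \<in> L}" if "a \<ge> M" for a
      using pending_M[OF T(2) that] that M_pos by (simp add: T(1) quotient_avoiding)
  qed
qed

section \<open>Words of which every embedding is a suffix\<close>

definition snoc_words :: "nat list set \<Rightarrow> nat list set" where
  "snoc_words L = {w @ [a] |w a. w \<in> L \<and> a > 0}"

lemma snoc_words_subset: "L \<subseteq> pos_words \<Longrightarrow> snoc_words L \<subseteq> pos_words"
  by (fastforce simp: snoc_words_def pos_words_def)

lemma weight_gf_snoc_words:
  assumes "L \<subseteq> pos_words"
  shows "weight_gf (snoc_words L) = letters_gf {0<..} * weight_gf L"
proof -
  have quot: "{w. a # w \<in> rev ` snoc_words L} = rev ` L" if "a > 0" for a
  proof (intro set_eqI)
    fix w
    have "a # w \<in> rev ` snoc_words L \<longleftrightarrow> rev w @ [a] \<in> snoc_words L"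
      by (metis image_iff rev.simps(2) rev_rev_ident)
    also have "\<dots> \<longleftrightarrow> w \<in> rev ` L"
      using that by (simp add: snoc_words_def) (metis image_iff rev_rev_ident)
    finally show "w \<in> {w. a # w \<in> rev ` snoc_words L} \<longleftrightarrow> w \<in> rev ` L" by simp
  qed
  have "weight_gf (rev ` snoc_words L) = letters_gf {0<..} * weight_gf (rev ` L)"
  proof -
    have sub: "rev ` snoc_words L \<subseteq> pos_words"
      using snoc_words_subset[OF assms] by (auto simp: pos_words_def)
    have eq: "{a. 0 < a \<and> {w. a # w \<in> rev ` snoc_words L} = rev ` L} = {0<..}"
      unfolding set_eq_iff[of "Collect _"] mem_Collect_eq greaterThan_iff using quot by blast
    have "[] \<notin> rev ` snoc_words L"
      by (auto simp: snoc_words_def)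
    then show ?thesis
      using weight_gf_quotients[OF sub, of "{rev ` L}"] quot by (simp add: eq)
  qed
  then show ?thesis by (simp only: weight_gf_rev)
qed

text \<open>For a nonempty word \<open>v @ [a]\<close>, an embedding inside \<open>v\<close> would
  be one that is not a suffix, which excludes the word from both sets. If \<open>v\<close> avoids
  \<open>u\<close>, every embedding must use the last letter.\<close>

lemma words_A_Un_words_S: "words_A u \<union> words_S u = {[]} \<union> snoc_words (words_A u)"
proof (intro equalityI subsetI)
  fix w assume w: "w \<in> words_A u \<union> words_S u"
  show "w \<in> {[]} \<union> snoc_words (words_A u)"
  proof (cases w rule: rev_cases)
    case (snoc v a)
    have "\<not> gfactor_le u v"
    proof
      assume "gfactor_le u v"
      then obtain p w' z where "embedding u v p w' z" unfolding gfactor_le_def by blast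
      then have "embedding u w p w' (z @ [a])" by (simp add: snoc embedding_def)
      then show False using w unfolding words_A_def words_S_def gfactor_le_def by blast
    qed
    then show ?thesis
      using w by (auto simp: snoc words_A_def words_S_def words_F_def pos_words_def snoc_words_def)
  qed simp
next
  fix w assume "w \<in> {[]} \<union> snoc_words (words_A u)"
  then consider "w = []" | v a where "w = v @ [a]" "v \<in> words_A u" "a > 0"
    by (auto simp: snoc_words_def)
  then show "w \<in> words_A u \<union> words_S u"
  proof cases
    \<comment> \<open>The empty word lies in \<open>words_S u\<close> if \<open>u = []\<close>, and
      in \<open>words_A u\<close> otherwise.\<close>
    case 1
    then show ?thesis
      by (auto simp: words_A_def words_S_def words_F_def embedding_def pos_words_def)
  next
    case 2
    have "z = []" if "embedding u w p w' z" for p w' z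
    proof (cases z rule: rev_cases)
      case (snoc z' b)
      then have "embedding u v p w' z'" using that 2 by (simp add: embedding_def)
      then show ?thesis using 2 unfolding words_A_def gfactor_le_def by blast
    qed
    then show ?thesis
      using 2 by (auto simp: words_A_def words_S_def words_F_def pos_words_def)
  qed
qed

lemma rational_words_S: "rational_fps2 (weight_gf (words_S u))"
proof -
  have A: "words_A u \<subseteq> pos_words" by (auto simp: words_A_def)
  have "weight_gf (words_A u) + weight_gf (words_S u) = weight_gf (words_A u \<union> words_S u)"
    using A by (intro weight_gf_Un_disjoint[symmetric]) (auto simp: words_A_def words_S_def words_F_def)
  also have "\<dots> = weight_gf {[]} + weight_gf (snoc_words (words_A u))"
    unfolding words_A_Un_words_S using snoc_words_subset[OF A]
    by (intro weight_gf_Un_disjoint) (auto simp: snoc_words_def pos_words_def)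
  also have "\<dots> = 1 + letters_gf {0<..} * weight_gf (words_A u)"
    using A by (simp add: weight_gf_snoc_words weight_gf_finite weight_def)
  finally have "weight_gf (words_S u) =
      1 + letters_gf {0<..} * weight_gf (words_A u) - weight_gf (words_A u)"
    by (simp add: algebra_simps)
  \<comment> \<open>This series is \<open>t x / (1 - x)\<close>; its indicator is constant from 1
    on.\<close>
  moreover have "rational_fps2 (letters_gf {0<..})"
    by (rule rational_letters_gf[of 1]) auto
  ultimately show ?thesis
    by (simp add: rational_fps2_add rational_fps2_diff rational_fps2_mult rational_fps2_1
        rational_words_A)
qed

section \<open>Words containing \<open>u\<close>, by complement, and the conclusion\<close>

lemma rational_words_F: "rational_fps2 (weight_gf (words_F u))"
proof -
  have "words_F u \<union> words_A u = pos_words"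
    by (auto simp: words_F_def words_A_def)
  moreover have "weight_gf (words_F u \<union> words_A u) = weight_gf (words_F u) + weight_gf (words_A u)"
    by (rule weight_gf_Un_disjoint) (auto simp: words_F_def words_A_def)
  ultimately have "weight_gf (words_F u) = weight_gf pos_words - weight_gf (words_A u)"
    by simp
  then show ?thesis
    by (simp add: rational_fps2_diff rational_words_A rational_weight_gf_pos_words)
qed

theorem theorem3p2:
  fixes u :: "nat list"
  assumes "u \<in> pos_words"
  shows "rational_fps2 (weight_gf (words_F u)) \<and>
         rational_fps2 (weight_gf (words_S u)) \<and>
         rational_fps2 (weight_gf (words_A u))"
  by (intro conjI rational_words_F rational_words_S rational_words_A)

end
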